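(* For every real number $\varepsilon>0$ there is a constant $k_{\varepsilon}>0$, depending only on $\varepsilon$, such that for every integer $c\ge 2$ there exist coprime positive integers $a,b$ with $a+b=c$ and $$k_{\varepsilon}\,R(c)^{1-\varepsilon}\,c^{2} < R(abc).$$
   Context: For a positive integer $n$, $R(n)$ denotes its radical, i.e. the product of the distinct primes dividing $n$ (with $R(1)=1$). *)

theory Defs
  imports Complex_Main "HOL-Computational_Algebra.Primes"
begin

definition nat_radical :: "nat \<Rightarrow> nat" where
  "nat_radical n = (\<Prod>p | prime p \<and> p dvd n. p)"

text \<open>For positive \<open>n\<close> the index set is finite, so the product is the intended one;
  for \<open>n = 0\<close> it is infinite and the library convention gives the value 1.\<close>

lemma nat_radical_eq_prime_factors:
  assumes "n > 0"
  shows "nat_radical n = \<Prod>(prime_factors n)"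
proof -
  have "{p. prime p \<and> p dvd n} = prime_factors n"
    using assms by (auto simp: prime_factors_dvd)
  then show ?thesis by (simp add: nat_radical_def)
qed

lemma nat_radical_1 [simp]: "nat_radical (Suc 0) = 1"
  using nat_radical_eq_prime_factors[of 1] by simp

end

theory Submission
  imports Defs "HOL-Number_Theory.Totient"
begin

text \<open>
  Write \<open>R\<close> for the radical. Since \<open>ln a - ln R(a)\<close> is the sum of \<open>ln p\<close> over all prime powers
  \<open>p\<^sup>k\<close> dividing \<open>a\<close> with \<open>k \<ge> 2\<close>, the nonnegative numbers \<open>ln (c / R(a))\<close>, \<open>1 \<le> a \<le> c\<close>, add up to
  \<open>O(c)\<close>. Restricting to the totatives \<open>a\<close> of \<open>c\<close> only decreases this sum, and \<open>a \<mapsto> c - a\<close>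
  permutes them, so for some totative \<open>ln (c\<^sup>2 / (R(a) R(c - a)))\<close> is \<open>O(c / \<phi>(c))\<close>. Finally
  \<open>c / \<phi>(c) \<le> \<omega>(c) + 1\<close>, and \<open>\<omega>(c)\<close> is at most \<open>\<delta> ln R(c)\<close> plus a constant depending on \<open>\<delta>\<close>, because
  all but boundedly many primes \<open>p\<close> satisfy \<open>ln p \<ge> 1 / \<delta>\<close>.
\<close>

section \<open>Elementary estimates for sums of logarithms\<close>

lemma ln_fact_lower_bound: "real n * ln (real n) - real n \<le> (\<Sum>a=1..n. ln (real a))"
proof (induction n)
  case (Suc n)
  \<comment> \<open>This is exactly what the induction step needs once the common terms
    cancel.\<close>
  have "real n * (ln (real (Suc n)) - ln (real n)) \<le> 1"
  proof (cases "n = 0")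
    case False
    have "ln (real (Suc n)) - ln (real n) = ln (1 + 1 / real n)"
      using False by (subst ln_divide_pos [symmetric]) (auto simp: field_simps)
    also have "\<dots> \<le> 1 / real n"
      by (rule ln_add_one_self_le_self) simp
    finally show ?thesis
      using False by (simp add: field_simps)
  qed simp
  with Suc show ?case by (simp add: algebra_simps)
qed simp

text \<open>Telescoping: each summand is at most the drop of \<open>(1 + ln x) / (x - 1)\<close>
  between \<open>x = m\<close> and \<open>x = m + 1\<close>.\<close>

lemma sum_ln_over_square_le: "(\<Sum>m=2..n. ln (real m) / (real m * (real m - 1))) \<le> 2"
proof -
  have "(\<Sum>m=2..n. ln (real m) / (real m * (real m - 1)))
      \<le> (1 + ln 2) - (1 + ln (real n + 1)) / real n" if "n \<ge> 1" for n
    using that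
  proof (induction n rule: dec_induct)
    case base
    show ?case by simp
  next
    case (step n)
    define x where "x = real n + 1"
    have x: "x > 1" using step x_def by simp
    have "ln (x + 1) - ln x = ln (1 + 1 / x)"
      using x by (subst ln_divide_pos [symmetric]) (auto simp: field_simps)
    also have "\<dots> \<le> 1 / x"
      using x by (intro ln_add_one_self_le_self) simp
    finally have d: "ln (x + 1) - ln x \<le> 1 / x" .
    have "(x - 1) * (ln (x + 1) - ln x) \<le> (x - 1) * (1 / x)"
      using d x by (intro mult_left_mono) auto
    also have "\<dots> \<le> 1" using x by (simp add: field_simps)
    finally have *: "(x - 1) * (ln (x + 1) - ln x) \<le> 1" .
    have "ln x / (x * (x - 1)) \<le> (x * (1 + ln x) - (x - 1) * (1 + ln (x + 1))) / (x * (x - 1))"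
      using * x by (intro divide_right_mono) (auto simp: algebra_simps)
    also have "\<dots> = (1 + ln x) / (x - 1) - (1 + ln (x + 1)) / x"
      using x by (simp add: diff_divide_distrib)
    finally have "ln x / (x * (x - 1)) \<le> (1 + ln x) / (x - 1) - (1 + ln (x + 1)) / x" .
    moreover have "{2..Suc n} = insert (Suc n) {2..n}" using step by auto
    ultimately show ?case
      using step.IH by (simp add: x_def add_ac)
  qed
  moreover have "ln 2 \<le> (1::real)" using ln_add_one_self_le_self[of 1] by simp
  moreover have "(1 + ln (real n + 1)) / real n \<ge> 0" by simp
  ultimately have "n \<ge> 1 \<Longrightarrow> ?thesis" by (smt (verit, best))
  then show ?thesis by (cases "n \<ge> 1") auto
qed

section \<open>The radical and its logarithm\<close>

lemma nat_radical_pos: "nat_radical n > 0"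
  unfolding nat_radical_def by (intro prod_pos) (auto intro: prime_gt_0_nat)

lemma nat_radical_le:
  assumes "n > 0"
  shows "nat_radical n \<le> n"
proof -
  have "nat_radical n = (\<Prod>p\<in>prime_factors n. p)"
    using assms nat_radical_eq_prime_factors by simp
  also have "\<dots> \<le> (\<Prod>p\<in>prime_factors n. p ^ multiplicity p n)"
    by (intro prod_mono)
      (auto simp: prime_factors_multiplicity intro!: self_le_power prime_ge_1_nat)
  also have "\<dots> = n"
    using assms prime_factorization_nat by simp
  finally show ?thesis .
qed

lemma nat_radical_mult:
  assumes "coprime m n" "m > 0" "n > 0"
  shows "nat_radical (m * n) = nat_radical m * nat_radical n"
proof -
  have "prime_factors m \<inter> prime_factors n = {}"
    using assms(1) by (metis coprime_common_divisor disjoint_iff in_prime_factors_iff not_prime_unit)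
  then show ?thesis
    using assms by (simp add: nat_radical_eq_prime_factors prime_factors_product prod.union_disjoint)
qed

lemma ln_nat_radical:
  assumes "n > 0"
  shows "ln (real (nat_radical n)) = (\<Sum>p\<in>prime_factors n. ln (real p))"
  using assms
  by (auto simp: nat_radical_eq_prime_factors in_prime_factors_iff intro!: ln_prod prime_gt_0_nat)

text \<open>A prime of multiplicity \<open>v\<close> in \<open>a\<close> contributes
  \<open>(v - 1) * ln p\<close> beyond the radical, one \<open>ln p\<close> for each
  \<open>k\<close> from 2 to \<open>v\<close>. Both ranges end at \<open>n\<close> instead of
  \<open>a\<close>, so that sums over \<open>a\<close> can later be interchanged with them.\<close>

lemma ln_eq_ln_nat_radical_plus:
  assumes "a > 0" "a \<le> n"
  shows "ln (real a) = ln (real (nat_radical a)) +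
    (\<Sum>p\<in>{p\<in>{2..n}. prime p}. \<Sum>k=2..n. if p ^ k dvd a then ln (real p) else 0)"
proof -
  have mult: "(\<Sum>k=2..n. if p ^ k dvd a then ln (real p) else 0)
      = (if p dvd a then (real (multiplicity p a) - 1) * ln (real p) else 0)"
    if p: "prime p" for p
  proof -
    have iff: "p ^ k dvd a \<longleftrightarrow> k \<le> multiplicity p a" for k
      using p assms by (intro power_dvd_iff_le_multiplicity) auto
    \<comment> \<open>The cutoff \<open>k \<le> n\<close> loses no exponent, since the multiplicity
      \<open>v\<close> satisfies \<open>v < 2 ^ v \<le> a \<le> n\<close>.\<close>
    have "2 ^ multiplicity p a \<le> p ^ multiplicity p a"
      using p by (intro power_mono) (auto intro: prime_ge_2_nat)
    also have "\<dots> \<le> a"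
      using assms by (intro dvd_imp_le multiplicity_dvd) auto
    finally have le: "multiplicity p a \<le> n"
      using assms(2) less_exp[of "multiplicity p a"] by linarith
    have "(\<Sum>k=2..n. if p ^ k dvd a then ln (real p) else 0)
        = (\<Sum>k\<in>{k\<in>{2..n}. k \<le> multiplicity p a}. ln (real p))"
      unfolding iff by (rule sum.inter_filter [symmetric]) simp
    also have "{k\<in>{2..n}. k \<le> multiplicity p a} = {2..multiplicity p a}"
      using le by auto
    \<comment> \<open>For multiplicity 0 the interval is empty although the real number
      \<open>v - 1\<close> is -1; hence the case distinction on \<open>p dvd a\<close>.\<close>
    finally show ?thesis
      using iff[of 1] by (auto simp: of_nat_diff not_less_eq_eq)
  qed
  have "ln (real a) = (\<Sum>p\<in>prime_factors a. real (multiplicity p a) * ln (real p))"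
  proof -
    have "ln (real a) = ln (\<Prod>p\<in>prime_factors a. real p ^ multiplicity p a)"
      using assms prime_factorization_nat[of a]
      by (metis (no_types, lifting) of_nat_power of_nat_prod prod.cong)
    also have "\<dots> = (\<Sum>p\<in>prime_factors a. ln (real p ^ multiplicity p a))"
      by (intro ln_prod) (auto simp: in_prime_factors_iff intro!: zero_less_power prime_gt_0_nat)
    finally show ?thesis
      by (simp add: ln_realpow)
  qed
  also have "\<dots> = ln (real (nat_radical a)) +
      (\<Sum>p\<in>prime_factors a. (real (multiplicity p a) - 1) * ln (real p))"
    using assms by (simp add: ln_nat_radical sum.distrib [symmetric] algebra_simps)
  also have "prime_factors a = {p\<in>{p\<in>{2..n}. prime p}. p dvd a}"
  proof -
    have "p \<in> {2..n}" if "prime p" "p dvd a" for p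
      using that prime_ge_2_nat[of p] dvd_imp_le[of p a] assms by simp
    then show ?thesis
      using assms by (auto simp: in_prime_factors_iff simp del: atLeastAtMost_iff)
  qed
  also have "(\<Sum>p\<in>\<dots>. (real (multiplicity p a) - 1) * ln (real p))
      = (\<Sum>p\<in>{p\<in>{2..n}. prime p}. if p dvd a then (real (multiplicity p a) - 1) * ln (real p) else 0)"
    by (intro sum.inter_filter) auto
  also have "\<dots> = (\<Sum>p\<in>{p\<in>{2..n}. prime p}. \<Sum>k=2..n. if p ^ k dvd a then ln (real p) else 0)"
    by (intro sum.cong refl) (simp add: mult)
  finally show ?thesis .
qed

section \<open>The average of \<open>ln (n / R(a))\<close> over all \<open>a\<close> up to
  \<open>n\<close>\<close>

lemma card_multiples_le:
  assumes "d > 0"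
  shows "real (card {a\<in>{1..n}. d dvd a}) \<le> real n / real d"
proof -
  have "{a\<in>{1..n}. d dvd a} \<subseteq> (\<lambda>i. d * i) ` {1..n div d}"
  proof
    fix a assume "a \<in> {a\<in>{1..n}. d dvd a}"
    then obtain i where "a = d * i" "1 \<le> d * i" "d * i \<le> n" by auto
    then show "a \<in> (\<lambda>i. d * i) ` {1..n div d}"
      using assms by (auto simp: less_eq_div_iff_mult_less_eq mult.commute)
  qed
  then have "card {a\<in>{1..n}. d dvd a} \<le> card ((\<lambda>i. d * i) ` {1..n div d})"
    by (intro card_mono) auto
  also have "\<dots> \<le> n div d"
    using card_image_le[of "{1..n div d}" "\<lambda>i. d * i"] by simp
  finally show ?thesis
    by (meson of_nat_mono of_nat_div_le_of_nat order_trans)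
qed

lemma sum_inverse_powers_le:
  assumes "x > (1::real)"
  shows "(\<Sum>k=2..n. 1 / x ^ k) \<le> 1 / (x * (x - 1))"
proof -
  have "(\<Sum>k=2..n. 1 / x ^ k) \<le> 1 / (x * (x - 1)) - 1 / (x ^ n * (x - 1))" if "n \<ge> 1" for n
    using that
  proof (induction n rule: dec_induct)
    case (step n)
    have "{2..Suc n} = insert (Suc n) {2..n}" using step by auto
    moreover have "1 / (x ^ n * (x - 1)) = 1 / x ^ Suc n + 1 / (x ^ Suc n * (x - 1))"
      using assms by (simp add: field_simps)
    ultimately show ?case using step.IH by simp
  qed simp
  moreover have "1 / (x ^ n * (x - 1)) \<ge> 0" "1 / (x * (x - 1)) \<ge> 0" using assms by auto
  ultimately have "n \<ge> 1 \<Longrightarrow> ?thesis" by (smt (verit, best))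
  then show ?thesis using \<open>1 / (x * (x - 1)) \<ge> 0\<close> by (cases "n \<ge> 1") auto
qed

text \<open>With the sums interchanged, a prime \<open>p\<close> accounts for at most
  \<open>n * ln p / (p * (p - 1))\<close>, in total at most \<open>2 * n\<close>. Replacing
  \<open>ln a\<close> by \<open>ln n\<close> costs at most another \<open>n\<close>.\<close>

lemma sum_ln_div_nat_radical_le:
  "(\<Sum>a=1..n. ln (real n / real (nat_radical a))) \<le> 3 * real n"
proof -
  define P where "P = {p\<in>{2..n}. prime p}"
  have "(\<Sum>a=1..n. ln (real a)) = (\<Sum>a=1..n. ln (real (nat_radical a))) +
      (\<Sum>a=1..n. \<Sum>p\<in>P. \<Sum>k=2..n. if p ^ k dvd a then ln (real p) else 0)"
    unfolding P_def sum.distrib [symmetric]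
    by (intro sum.cong refl ln_eq_ln_nat_radical_plus) auto
  also have "(\<Sum>a=1..n. \<Sum>p\<in>P. \<Sum>k=2..n. if p ^ k dvd a then ln (real p) else 0)
      = (\<Sum>p\<in>P. \<Sum>k=2..n. \<Sum>a=1..n. if p ^ k dvd a then ln (real p) else 0)"
    by (subst sum.swap, rule sum.cong [OF refl], rule sum.swap)
  also have "\<dots> = (\<Sum>p\<in>P. \<Sum>k=2..n. real (card {a\<in>{1..n}. p ^ k dvd a}) * ln (real p))"
    by (simp add: sum.inter_filter [symmetric])
  also have "\<dots> \<le> (\<Sum>p\<in>P. \<Sum>k=2..n. real n / real (p ^ k) * ln (real p))"
    by (intro sum_mono mult_right_mono card_multiples_le)
      (auto simp: P_def prime_gt_0_nat ln_ge_zero prime_ge_1_nat)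
  also have "\<dots> = (\<Sum>p\<in>P. real n * ln (real p) * (\<Sum>k=2..n. 1 / real p ^ k))"
    by (simp add: sum_distrib_left mult_ac)
  also have "\<dots> \<le> (\<Sum>p\<in>P. real n * ln (real p) * (1 / (real p * (real p - 1))))"
    by (intro sum_mono mult_left_mono sum_inverse_powers_le) (auto simp: P_def)
  also have "\<dots> \<le> (\<Sum>p=2..n. real n * ln (real p) * (1 / (real p * (real p - 1))))"
    by (intro sum_mono2) (auto simp: P_def)
  also have "\<dots> = real n * (\<Sum>p=2..n. ln (real p) / (real p * (real p - 1)))"
    by (simp add: sum_distrib_left)
  also have "\<dots> \<le> real n * 2"
    by (intro mult_left_mono sum_ln_over_square_le) simp
  finally have "(\<Sum>a=1..n. ln (real a)) \<le> (\<Sum>a=1..n. ln (real (nat_radical a))) + real n * 2"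
    by simp
  moreover have "(\<Sum>a=1..n. ln (real n / real (nat_radical a)))
      = real n * ln (real n) - (\<Sum>a=1..n. ln (real (nat_radical a)))"
    by (simp add: ln_divide_pos nat_radical_pos sum_subtractf)
  ultimately show ?thesis
    using ln_fact_lower_bound[of n] by simp
qed

section \<open>The totient and the number of prime factors\<close>

lemma prod_one_minus_inverse_ge:
  assumes "finite S" "\<And>m. m \<in> S \<Longrightarrow> m \<ge> (2::nat)"
  shows "(\<Prod>m\<in>S. 1 - 1 / real m) \<ge> 1 / (real (card S) + 1)"
  using assms
  \<comment> \<open>The \<open>i\<close>-th smallest element of \<open>S\<close> is at least \<open>i + 1\<close>, so a telescoping product bounds this one from below.\<close>
proof (induction S rule: finite_linorder_max_induct)
  case (insert m S)
  have "S \<subseteq> {2..<m}" using insert by auto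
  then have "card S \<le> m - 2"
    using card_mono[of "{2..<m}" S] by simp
  then have le: "real (card S) + 2 \<le> real m"
    using insert.prems[of m] by simp
  have "1 / (real (card S) + 2) = (1 - 1 / (real (card S) + 2)) * (1 / (real (card S) + 1))"
    by (simp add: divide_simps)
  also have "\<dots> \<le> (1 - 1 / real m) * (\<Prod>m\<in>S. 1 - 1 / real m)"
    using le insert by (intro mult_mono diff_left_mono divide_left_mono) auto
  also have "\<dots> = (\<Prod>m\<in>insert m S. 1 - 1 / real m)"
    using insert by (subst prod.insert) auto
  finally show ?case
    using insert by (subst card_insert_disjoint) (auto simp: add_ac)
qed simp

text \<open>The product formula for \<open>totient c / c\<close> runs over distinct integers that
  are at least 2, so the preceding bound applies.\<close>

lemma le_totient_mult_card_prime_factors: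
  assumes "c > 0"
  shows "real c \<le> (real (card (prime_factors c)) + 1) * real (totient c)"
proof -
  have "1 / (real (card (prime_factors c)) + 1) \<le> (\<Prod>p\<in>prime_factors c. 1 - 1 / real p)"
    by (intro prod_one_minus_inverse_ge) (auto simp: in_prime_factors_iff prime_ge_2_nat)
  then have "real c * (1 / (real (card (prime_factors c)) + 1)) \<le> real (totient c)"
    by (subst totient_formula2) (intro mult_left_mono, auto)
  then show ?thesis by (simp add: field_simps)
qed

text \<open>At most \<open>N\<close> prime factors lie below \<open>N\<close>. Each of the others
  has logarithm at least \<open>1 / \<delta>\<close>, and these logarithms add up to at most
  \<open>ln R(c)\<close>.\<close>

lemma card_prime_factors_le:
  assumes "\<delta> > 0" "exp (1 / \<delta>) \<le> real N" "c > 0"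
  shows "real (card (prime_factors c)) \<le> real N + \<delta> * ln (real (nat_radical c))"
proof -
  define B where "B = {p\<in>prime_factors c. p \<ge> N}"
  have "card (prime_factors c) \<le> card ({..<N} \<union> B)"
    by (intro card_mono) (auto simp: B_def)
  also have "\<dots> \<le> N + card B"
    using card_Un_le[of "{..<N}" B] by simp
  finally have card: "real (card (prime_factors c)) \<le> real N + real (card B)" by linarith
  have "real (card B) * (1 / \<delta>) = (\<Sum>p\<in>B. 1 / \<delta>)" by simp
  also have "\<dots> \<le> (\<Sum>p\<in>B. ln (real p))"
  proof (intro sum_mono)
    fix p assume "p \<in> B"
    then have "exp (1 / \<delta>) \<le> real p" using assms(2) by (simp add: B_def)
    then show "1 / \<delta> \<le> ln (real p)"
      by (metis exp_gt_zero ln_exp ln_mono order_less_le_trans)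
  qed
  also have "\<dots> \<le> (\<Sum>p\<in>prime_factors c. ln (real p))"
    by (intro sum_mono2) (auto simp: B_def in_prime_factors_iff prime_ge_1_nat ln_ge_zero)
  also have "\<dots> = ln (real (nat_radical c))"
    using assms(3) by (simp add: ln_nat_radical)
  finally have "real (card B) \<le> \<delta> * ln (real (nat_radical c))"
    using assms(1) by (simp add: field_simps)
  with card show ?thesis by simp
qed

section \<open>Choosing a totative and concluding\<close>

lemma exists_totative_large_nat_radicals:
  assumes "c \<ge> 2"
  obtains a where "a \<in> totatives c" "a < c"
    "ln (real c / real (nat_radical a)) + ln (real c / real (nat_radical (c - a)))
      \<le> 6 * (real (card (prime_factors c)) + 1)"
proof -
  define f where "f a = ln (real c / real (nat_radical a))" for a
  define W where "W = 6 * (real (card (prime_factors c)) + 1)"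
  have less: "a < c" if "a \<in> totatives c" for a
    using totatives_less[OF that] assms by simp
  have inv: "c - a \<in> totatives c" if "a \<in> totatives c" for a
    using that less[OF that] gcd_diff2_nat[of a c]
    by (auto simp: in_totatives_iff coprime_iff_gcd_eq_1 gcd.commute)
  have nonneg: "f a \<ge> 0" if "a \<in> {1..c}" for a
  proof -
    have "nat_radical a \<le> c"
      using nat_radical_le[of a] that by auto
    then show ?thesis
      unfolding f_def using nat_radical_pos[of a] by (intro ln_ge_zero) (simp add: field_simps)
  qed
  have "(\<Sum>a\<in>totatives c. f (c - a)) = (\<Sum>a\<in>totatives c. f a)"
    using inv less by (intro sum.reindex_bij_witness[of _ "\<lambda>a. c - a" "\<lambda>a. c - a"]) (auto simp: less_imp_le)
  then have "(\<Sum>a\<in>totatives c. f a + f (c - a)) = 2 * (\<Sum>a\<in>totatives c. f a)"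
    by (simp add: sum.distrib)
  \<comment> \<open>Nonnegativity of \<open>f\<close> permits enlarging the range from the totatives
    to all of \<open>{1..c}\<close>.\<close>
  also have "\<dots> \<le> 2 * (\<Sum>a=1..c. f a)"
    using nonneg by (intro mult_left_mono sum_mono2) (auto simp: in_totatives_iff)
  also have "\<dots> \<le> 6 * real c"
    using sum_ln_div_nat_radical_le[of c] by (simp add: f_def)
  also have "\<dots> \<le> W * real (totient c)"
    using le_totient_mult_card_prime_factors[of c] assms by (simp add: W_def algebra_simps)
  also have "\<dots> = (\<Sum>a\<in>totatives c. W)"
    by (simp add: totient_def)
  finally have sum: "(\<Sum>a\<in>totatives c. f a + f (c - a)) \<le> (\<Sum>a\<in>totatives c. W)" .
  have "totatives c \<noteq> {}" using assms by simp
  \<comment> \<open>If every totative exceeded \<open>W\<close>, summing over the nonempty set would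
    contradict \<open>sum\<close>.\<close>
  then have "\<exists>a\<in>totatives c. f a + f (c - a) \<le> W"
    using sum sum_strict_mono[of "totatives c" "\<lambda>_. W" "\<lambda>a. f a + f (c - a)"] by force
  then show ?thesis
    using that less unfolding f_def W_def by blast
qed

theorem theorem4:
  shows "\<forall>\<epsilon>::real. \<epsilon> > 0 \<longrightarrow>
    (\<exists>k::real. k > 0 \<and>
      (\<forall>c::nat. c \<ge> 2 \<longrightarrow>
        (\<exists>a b :: nat. a > 0 \<and> b > 0 \<and> coprime a b \<and> a + b = c \<and>
          k * real (nat_radical c) powr (1 - \<epsilon>) * real c ^ 2 < real (nat_radical (a * b * c)))))"
proof (intro allI impI)
  fix \<epsilon> :: real
  assume \<epsilon>: "\<epsilon> > 0"
  \<comment> \<open>Taking \<open>\<delta> = \<epsilon> / 6\<close> offsets the factor 6 in the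
    bound for the chosen totative; \<open>K\<close> collects what does not depend on
    \<open>c\<close>.\<close>
  obtain N :: nat where N: "exp (1 / (\<epsilon> / 6)) \<le> real N"
    using real_arch_simple by blast
  define K where "K = 6 * (real N + 1)"
  show "\<exists>k::real. k > 0 \<and>
      (\<forall>c::nat. c \<ge> 2 \<longrightarrow>
        (\<exists>a b :: nat. a > 0 \<and> b > 0 \<and> coprime a b \<and> a + b = c \<and>
          k * real (nat_radical c) powr (1 - \<epsilon>) * real c ^ 2 < real (nat_radical (a * b * c))))"
  \<comment> \<open>The logarithmic estimate yields only a weak inequality with
    \<open>exp (- K)\<close>; halving this constant makes it strict.\<close>
  proof (intro exI[of _ "exp (- K) / 2"] conjI allI impI)
    fix c :: nat
    assume c: "c \<ge> 2"
    obtain a where a: "a \<in> totatives c" "a < c"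
      and le: "ln (real c / real (nat_radical a)) + ln (real c / real (nat_radical (c - a)))
        \<le> 6 * (real (card (prime_factors c)) + 1)"
      using exists_totative_large_nat_radicals[OF c] by blast
    define b where "b = c - a"
    have ab: "a > 0" "b > 0" "a + b = c" "coprime a c"
      using a by (auto simp: b_def in_totatives_iff)
    have "coprime a b" "coprime b c"
      using ab(3,4) gcd_diff2_nat[of a c] by (auto simp: coprime_iff_gcd_eq_1)
    with ab have cop: "coprime a b" "coprime (a * b) c" by auto
    define A B C where "A = real (nat_radical a)" and "B = real (nat_radical b)"
      and "C = real (nat_radical c)"
    have pos: "A > 0" "B > 0" "C > 0"
      by (simp_all add: A_def B_def C_def nat_radical_pos)
    have "6 * (real (card (prime_factors c)) + 1) \<le> K + \<epsilon> * ln C"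
      using card_prime_factors_le[OF _ N, of c] \<epsilon> c by (simp add: K_def C_def)
    with le have "2 * ln (real c) - ln A - ln B \<le> K + \<epsilon> * ln C"
      using pos c by (simp add: A_def B_def b_def ln_divide_pos)
    \<comment> \<open>Adding \<open>ln C\<close> to both sides completes the logarithm of
      \<open>R(abc)\<close> and produces the exponent \<open>1 - \<epsilon>\<close>.\<close>
    then have "- K + (1 - \<epsilon>) * ln C + 2 * ln (real c) \<le> ln A + ln B + ln C"
      by (simp add: algebra_simps)
    then have "exp (- K + (1 - \<epsilon>) * ln C + 2 * ln (real c)) \<le> exp (ln A + ln B + ln C)"
      by simp
    then have "exp (- K) * C powr (1 - \<epsilon>) * real c ^ 2 \<le> A * B * C"
      using pos c by (simp add: exp_add exp_diff exp_minus powr_def exp_double field_simps)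
    moreover have "nat_radical (a * b * c) = nat_radical a * nat_radical b * nat_radical c"
      using ab cop c by (simp add: nat_radical_mult)
    moreover have "exp (- K) * C powr (1 - \<epsilon>) * real c ^ 2 > 0"
      using pos c by simp
    ultimately have "exp (- K) / 2 * C powr (1 - \<epsilon>) * real c ^ 2 < real (nat_radical (a * b * c))"
      by (simp add: A_def B_def C_def)
    then show "\<exists>a b. a > 0 \<and> b > 0 \<and> coprime a b \<and> a + b = c \<and>
        exp (- K) / 2 * real (nat_radical c) powr (1 - \<epsilon>) * real c ^ 2 < real (nat_radical (a * b * c))"
      using ab cop C_def by blast
  qed simp
qed

end
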